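(* $$|AI_n(3421,4312)|=|RAI_n(3421,4312)|=F_{n-1},$$ where $F_k$ is the $k$-th Fibonacci number.
   Context: Let $S_n$ be the set of permutations $\pi=\pi_1\ldots\pi_n$ of $\{1,\ldots,n\}$. A permutation is alternating if, for all $1\le i\le n-1$, $\pi_i<\pi_{i+1}$ if and only if $i$ is odd; it is reverse alternating if, for all $1\le i\le n-1$, $\pi_i>\pi_{i+1}$ if and only if $i$ is odd. $AI_n$ (resp. $RAI_n$) is the set of alternating (resp. reverse alternating) involutions ($\pi=\pi^{-1}$) in $S_n$. A permutation $\pi\in S_n$ avoids the pattern $\tau\in S_k$ if there are no indices $i_1<\cdots<i_k$ such that $\pi_{i_1}\ldots\pi_{i_k}$ is order-isomorphic to $\tau$; $AI_n(\sigma,\tau)$ and $RAI_n(\sigma,\tau)$ are the subsets of elements avoiding both $\sigma$ and $\tau$. (Since $4312=3421^{-1}$, an involution avoids both patterns if and only if it avoids either one.) The Fibonacci numbers $F_k$ are those of OEIS sequence A000045: $F_0=0$, $F_1=1$, $F_k=F_{k-1}+F_{k-2}$.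
   Formalization: The claim is proved for n ≥ 2: for n = 1 both sets contain the single permutation 1 while F_0 = 0, so the formula fails, and for n = 0 the number F_{-1} is not defined. *)

theory Defs
  imports "HOL-Number_Theory.Fib" "HOL-Combinatorics.Permutations"
begin

text \<open>
  A permutation in $S_n$ is a function \<open>p :: nat \<Rightarrow> nat\<close> with \<open>p permutes {1..n}\<close>, so \<open>p i\<close>
  is the $i$-th letter of the word, and \<open>p\<close> is the identity outside \<open>{1..n}\<close>.
\<close>

definition alternating :: "nat \<Rightarrow> (nat \<Rightarrow> nat) \<Rightarrow> bool" where
  "alternating n p \<longleftrightarrow> (\<forall>i\<in>{1..<n}. p i < p (i + 1) \<longleftrightarrow> odd i)"

definition reverse_alternating :: "nat \<Rightarrow> (nat \<Rightarrow> nat) \<Rightarrow> bool" where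
  "reverse_alternating n p \<longleftrightarrow> (\<forall>i\<in>{1..<n}. p i > p (i + 1) \<longleftrightarrow> odd i)"

text \<open>
  Patterns are given as words in one-line notation. List positions start at 0, so the
  indices $i_1 < \dots < i_k$ of an occurrence appear as \<open>f 0 < \<dots> < f (k - 1)\<close>.
\<close>

definition contains_pattern :: "nat \<Rightarrow> (nat \<Rightarrow> nat) \<Rightarrow> nat list \<Rightarrow> bool" where
  "contains_pattern n p t \<longleftrightarrow>
    (\<exists>f. strict_mono_on {..<length t} f \<and> f ` {..<length t} \<subseteq> {1..n} \<and>
         (\<forall>a<length t. \<forall>b<length t. p (f a) < p (f b) \<longleftrightarrow> t ! a < t ! b))"

definition avoids :: "nat \<Rightarrow> (nat \<Rightarrow> nat) \<Rightarrow> nat list \<Rightarrow> bool" where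
  "avoids n p t \<longleftrightarrow> \<not> contains_pattern n p t"

definition AI :: "nat \<Rightarrow> (nat \<Rightarrow> nat) set" where
  "AI n = {p. p permutes {1..n} \<and> inv p = p \<and> alternating n p}"

definition RAI :: "nat \<Rightarrow> (nat \<Rightarrow> nat) set" where
  "RAI n = {p. p permutes {1..n} \<and> inv p = p \<and> reverse_alternating n p}"

definition AI_avoiding :: "nat \<Rightarrow> nat list \<Rightarrow> nat list \<Rightarrow> (nat \<Rightarrow> nat) set" where
  "AI_avoiding n s t = {p \<in> AI n. avoids n p s \<and> avoids n p t}"

definition RAI_avoiding :: "nat \<Rightarrow> nat list \<Rightarrow> nat list \<Rightarrow> (nat \<Rightarrow> nat) set" where
  "RAI_avoiding n s t = {p \<in> RAI n. avoids n p s \<and> avoids n p t}"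

end

theory Submission
  imports Defs
begin

text \<open>
  An involution avoids 4312 as soon as it avoids 3421. Fix \<open>n\<close> and let the left end \<open>l\<close> of the
  window \<open>{l..n}\<close> vary; permutations are the identity outside the window, so no relabelling is
  ever needed. A reverse alternating avoider either starts with the arc \<open>l\<close>--\<open>l+1\<close>, or
  \<open>l+1\<close> is fixed and \<open>l\<close> opens a longer arc. In the latter case only three things can happen at
  \<open>l+2\<close>, \<open>l+3\<close>: the arc from \<open>l\<close> closes at \<open>l+3\<close> while \<open>l+2\<close> is fixed; it closes at \<open>l+3\<close>
  while \<open>l+2\<close> opens a new arc; or \<open>l+2\<close>--\<open>l+3\<close> is an arc nested below it. Deleting what has been
  completed gives, for the numbers \<open>s\<close> (all) and \<open>b\<close> (second point fixed) at window length
  \<open>d + 1\<close>, that \<open>s d = b d + s (d - 2)\<close> and \<open>b d = b (d - 2) + s (d - 2)\<close>, so \<open>s d = fib d\<close> and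
  \<open>b d = fib (d - 1)\<close>. An alternating avoider either fixes 1, or 1--3 is an arc and removing it
  leaves an object of the second kind on \<open>{2..n}\<close>.
\<close>

section \<open>Involutions avoiding 3421 on a window\<close>

text \<open>Positions range over all naturals, so the condition is the same for every window: in the
  involutions below, points outside the window are fixed and lie in no inversion, hence in no
  occurrence.\<close>

definition av3421 :: "(nat \<Rightarrow> nat) \<Rightarrow> bool" where
  "av3421 p \<longleftrightarrow> (\<forall>i j k m. i < j \<longrightarrow> j < k \<longrightarrow> k < m \<longrightarrow> \<not> (p m < p k \<and> p k < p i \<and> p i < p j))"

definition Inv :: "nat \<Rightarrow> nat \<Rightarrow> (nat \<Rightarrow> nat) set" where
  "Inv l n = {p. (\<forall>x. p (p x) = x) \<and> (\<forall>x. x < l \<or> n < x \<longrightarrow> p x = x) \<and> av3421 p}"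

text \<open>Parity is counted from \<open>l\<close>, so every window starts with a descent:
  \<open>l = 1\<close> gives reverse alternating words, \<open>l = 2\<close> what follows the first
  ascent of an alternating word.\<close>

definition zigzag :: "nat \<Rightarrow> nat \<Rightarrow> (nat \<Rightarrow> nat) \<Rightarrow> bool" where
  "zigzag l n p \<longleftrightarrow> (\<forall>i. l \<le> i \<longrightarrow> i < n \<longrightarrow> (p (Suc i) < p i \<longleftrightarrow> even (i + l)))"

definition Zig :: "nat \<Rightarrow> nat \<Rightarrow> (nat \<Rightarrow> nat) set" where
  "Zig l n = {p \<in> Inv l n. zigzag l n p}"

text \<open>There is no condition at position \<open>l+1\<close>, so that the word 321 (of length 3) is included: it
  arises from 42513 by deleting the arc \<open>l\<close>--\<open>l+3\<close> and the fixed point \<open>l+1\<close>.\<close>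

definition Fixed_second :: "nat \<Rightarrow> nat \<Rightarrow> (nat \<Rightarrow> nat) set" where
  "Fixed_second l n = {p \<in> Inv l n. l < n \<and> p (l+1) = l+1 \<and> p l > l+1 \<and> zigzag (l+2) n p}"

text \<open>What remains of \<open>Zig\<close> when \<open>l\<close>--\<open>l+1\<close> is not an
  arc; it agrees with \<open>Fixed_second\<close> except on windows of exactly three points.\<close>

definition Long_zig :: "nat \<Rightarrow> nat \<Rightarrow> (nat \<Rightarrow> nat) set" where
  "Long_zig l n = {p \<in> Zig l n. l < n \<and> p l \<noteq> l+1}"

lemma av3421D: "av3421 p \<Longrightarrow> i < j \<Longrightarrow> j < k \<Longrightarrow> k < m \<Longrightarrow> p m < p k \<Longrightarrow> p k < p i \<Longrightarrow> p i < p j \<Longrightarrow> False"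
  unfolding av3421_def by blast

lemma av3421I:
  "(\<And>i j k m. i < j \<Longrightarrow> j < k \<Longrightarrow> k < m \<Longrightarrow> p m < p k \<Longrightarrow> p k < p i \<Longrightarrow> p i < p j \<Longrightarrow> False) \<Longrightarrow> av3421 p"
  unfolding av3421_def by blast

lemma zigzag_step:
  "zigzag l n p \<longleftrightarrow> (l < n \<longrightarrow> p (l+1) < p l) \<and> (l+1 < n \<longrightarrow> \<not> p (l+2) < p (l+1)) \<and> zigzag (l+2) n p"
proof -
  have "(l \<le> i) = (i = l \<or> i = l+1 \<or> l+2 \<le> i)" for i by linarith
  then show ?thesis unfolding zigzag_def by auto
qed

lemma zigzag_cong:
  assumes "\<And>i. l \<le> i \<Longrightarrow> i < n \<Longrightarrow> p (Suc i) < p i \<longleftrightarrow> q (Suc i) < q i"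
  shows "zigzag l n p = zigzag l n q"
  using assms unfolding zigzag_def by auto

lemma Inv_invol: "p \<in> Inv l n \<Longrightarrow> p (p x) = x"
  by (auto simp: Inv_def)

lemma Inv_outside: "p \<in> Inv l n \<Longrightarrow> x < l \<or> n < x \<Longrightarrow> p x = x"
  by (auto simp: Inv_def)

lemma Inv_av: "p \<in> Inv l n \<Longrightarrow> av3421 p"
  by (auto simp: Inv_def)

lemma Inv_inside: 
  assumes "p \<in> Inv l n" "l \<le> x" "x \<le> n"
  shows "l \<le> p x \<and> p x \<le> n"
  using assms Inv_outside[of p l n "p x"] Inv_invol[of p l n x] by (metis not_le)

lemma finite_Inv: "finite (Inv l n)"
proof (rule finite_subset)
  show "Inv l n \<subseteq> {p. p permutes {l..n}}"
  proof
    fix p assume p: "p \<in> Inv l n"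
    have "\<exists>!x. p x = y" for y
      using Inv_invol[OF p] by metis
    then show "p \<in> {p. p permutes {l..n}}"
      using Inv_outside[OF p] by (auto simp: permutes_def)
  qed
qed (simp add: finite_permutations)

section \<open>The first letters of a reverse alternating avoider\<close>

text \<open>If \<open>l+1\<close> also opened an arc, that arc would close before the one from
  \<open>l\<close>, and the positions \<open>l+1\<close>, \<open>l+2\<close>,
  \<open>p (l+1)\<close>, \<open>p l\<close> would carry 3421.\<close>

lemma Zig_second_fixed:
  assumes "p \<in> Long_zig l n"
  shows "p (l+1) = l+1" "p l > l+1" "l+1 < n"
proof -
  have I: "p \<in> Inv l n" and z: "zigzag l n p" and ln: "l < n" "p l \<noteq> l+1" 
    using assms by (auto simp: Long_zig_def Zig_def)
  note inv = Inv_invol[OF I] and ins = Inv_inside[OF I] and av = Inv_av[OF I]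
  note st = z[unfolded zigzag_step[of l]]
  have lt: "p (l+1) < p l" using st ln by auto
  then show pl: "p l > l+1" using ins[of "l+1"] ln by linarith
  then show ln1: "l+1 < n" using ins[of l] ln by linarith
  then have asc: "\<not> p (l+2) < p (l+1)" using st by auto
  have ne: "p (l+1) \<noteq> l" using inv[of "l+1"] ln by auto
  show "p (l+1) = l+1"
  proof (rule ccontr)
    assume "p (l+1) \<noteq> l+1"
    then have k: "p (l+1) > l+1" using ne ins[of "l+1"] ln by linarith
    have "p (l+2) \<noteq> p (l+1)" using inv by (metis add_left_cancel one_eq_numeral_iff semiring_norm(85))
    then have a: "p (l+1) < p (l+2)" using asc by linarith
    have k3: "p (l+1) \<noteq> l+2" using inv[of "l+1"] a by auto
    show False
      by (rule av3421D[OF av, of "l+1" "l+2" "p (l+1)" "p l"]) (use k k3 a lt inv in auto)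
  qed
qed

lemma Long_zig_eq:
  "Long_zig l n = {p \<in> Fixed_second l n. l+1 < n \<and> p (l+1) < p (l+2)}"
proof (intro set_eqI iffI)
  fix p assume p: "p \<in> Long_zig l n"
  note f = Zig_second_fixed[OF p]
  have I: "p \<in> Inv l n" and z: "zigzag l n p" and ln: "l < n" 
    using p by (auto simp: Long_zig_def Zig_def)
  have "p (l+2) \<noteq> p (l+1)" using Inv_invol[OF I] 
    by (metis add_left_cancel one_eq_numeral_iff semiring_norm(85))
  then show "p \<in> {p \<in> Fixed_second l n. l+1 < n \<and> p (l+1) < p (l+2)}"
    using f I z[unfolded zigzag_step[of l]] by (auto simp: Fixed_second_def)
next
  fix p assume p: "p \<in> {p \<in> Fixed_second l n. l+1 < n \<and> p (l+1) < p (l+2)}"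
  then show "p \<in> Long_zig l n"
    unfolding Fixed_second_def Long_zig_def Zig_def 
    using zigzag_step[of l n p] by auto
qed

text \<open>The missing ascent at \<open>l+1\<close> follows from the descent at \<open>l+2\<close>,
  which exists for \<open>l+2 < n\<close>: it excludes the value \<open>l\<close> at
  \<open>l+2\<close>, and \<open>l+1\<close> is already taken. On three points 321 is the
  exception.\<close>

lemma Fixed_second_eq_Long_zig:
  assumes "l+2 < n"
  shows "Fixed_second l n = Long_zig l n"
proof -
  have "p (l+1) < p (l+2)" if p: "p \<in> Fixed_second l n" for p
  proof -
    have I: "p \<in> Inv l n" and f: "p (l+1) = l+1" "p l > l+1" and z: "zigzag (l+2) n p"
      using p by (auto simp: Fixed_second_def)
    have lt: "p (l+3) < p (l+2)" using z[unfolded zigzag_step[of "l+2"]] assms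
      by (simp add: numeral_eq_Suc)
    have "p (l+2) \<ge> l" using Inv_inside[OF I, of "l+2"] assms by auto
    moreover have "p (l+2) \<noteq> l" 
    proof
      assume "p (l+2) = l"
      then show False using lt Inv_inside[OF I, of "l+3"] assms by auto
    qed
    moreover have "p (l+2) \<noteq> l+1" using Inv_invol[OF I, of "l+2"] f by auto
    ultimately show ?thesis using f by linarith
  qed
  then show ?thesis unfolding Long_zig_eq using assms by auto
qed

section \<open>Adding, removing and relinking arcs\<close>

text \<open>The pattern 3421 is sum-indecomposable, so an occurrence cannot straddle a cut.\<close>

lemma av3421_extend_left:
  assumes "\<And>x. x \<ge> c \<Longrightarrow> p x \<ge> c"
    and "\<And>x. x < c \<Longrightarrow> q x < c" "\<And>x. x \<ge> c \<Longrightarrow> q x = p x"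
    and q: "\<And>i j k m. i < j \<Longrightarrow> j < k \<Longrightarrow> k < m \<Longrightarrow> m < c \<Longrightarrow> q m < q k \<Longrightarrow> q k < q i \<Longrightarrow> q i < q j \<Longrightarrow> False"
    and p: "av3421 p"
  shows "av3421 q"
proof (rule av3421I)
  fix i j k m assume o: "i < j" "j < k" "k < m" "q m < q k" "q k < q i" "q i < q j"
  show False
  proof (cases "m < c")
    case True then show False using q o by blast
  next
    case False
    then have "q m \<ge> c" using assms by auto
    then have "q i \<ge> c" using o by linarith
    then have "i \<ge> c" using assms(2)[of i] by linarith
    then show False using av3421D[OF p, of i j k m] o assms(3) by auto
  qed
qed

text \<open>Below \<open>l\<close> every point is fixed, and so is every smaller value, so such a
  point is never the larger entry of an inversion. This puts the first letter of any occurrence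
  inside the window.\<close>

lemma Inv_occurrence_ge:
  fixes p :: "nat \<Rightarrow> nat"
  assumes "\<And>x. p (p x) = x" "\<And>x. x < l \<Longrightarrow> p x = x" "i < m" "p m < p i"
  shows "l \<le> i"
proof (rule ccontr)
  assume "\<not> l \<le> i"
  then have "p i = i" using assms(2)[of i] by simp
  moreover from this have "p (p m) = p m" using assms(2)[of "p m"] assms(4) \<open>\<not> l \<le> i\<close> by auto
  ultimately show False using assms(1)[of m] assms(3,4) by simp
qed

text \<open>Since \<open>p\<close> is the identity up to \<open>b\<close>, the composition puts the
  block \<open>b, l+1, ..., b-1, l\<close> in front. An occurrence inside it cannot start with the
  maximum \<open>b\<close>, and one starting at a fixed point needs two later entries below their
  positions, while only the one at \<open>b\<close> is.\<close>

lemma Inv_plus_arc: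
  assumes p: "p \<in> Inv (Suc b) n" and "l < b" "b \<le> n"
  shows "p \<circ> transpose l b \<in> Inv l n"
proof -
  note inv = Inv_invol[OF p] and out = Inv_outside[OF p]
  define q where "q = p \<circ> transpose l b"
  have v: "q l = b" "q b = l" "\<And>x. x < Suc b \<Longrightarrow> x \<noteq> l \<Longrightarrow> x \<noteq> b \<Longrightarrow> q x = x"
     "\<And>x. x \<ge> Suc b \<Longrightarrow> q x = p x"
    using out assms(2) by (auto simp: q_def transpose_def)
  have pge: "p x \<ge> Suc b" if "x \<ge> Suc b" for x
    using inv[of x] out[of "p x"] that by (metis not_le)
  have qq: "q (q x) = x" for x
    using v(1,2) v(3)[of x] v(4)[of x] v(4)[of "p x"] pge[of x] inv[of x]
    by (cases "x \<ge> Suc b"; cases "x = l"; cases "x = b") auto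
  have "av3421 q"
  proof (rule av3421_extend_left[where c = "Suc b" and p = p])
    show "q x < Suc b" if "x < Suc b" for x
      using v that assms(2) by (metis less_SucI lessI)
    fix i j k m assume o: "i < j" "j < k" "k < m" "m < Suc b" "q m < q k" "q k < q i" "q i < q j"
    have "l \<le> i"
      by (rule Inv_occurrence_ge[of q l i m]) (use qq v(3) assms(2) o in auto)
    have val: "q x = x \<or> x = b \<and> q x = l" if "x > l" "x < Suc b" for x
      using v(2) v(3)[of x] that by (cases "x = b") auto
    have "q j = j \<or> j = b \<and> q j = l" "q k = k \<or> k = b \<and> q k = l" "q m = m \<or> m = b \<and> q m = l"
      by (rule val; use o \<open>l \<le> i\<close> in linarith)+
    moreover have "i = l \<and> q i = b \<or> q i = i"
      using v(1) v(3)[of i] \<open>l \<le> i\<close> o by auto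
    ultimately show False using o by linarith
  qed (use pge v(4) Inv_av[OF p] in auto)
  moreover have "q x = x" if "x < l \<or> n < x" for x
    using that v(3)[of x] v(4)[of x] out[of x] assms(2,3) by (cases "x < Suc b") auto
  ultimately show ?thesis using qq unfolding Inv_def q_def[symmetric] by simp
qed

text \<open>The arc and the fixed points under it form a block that \<open>p\<close> maps to itself,
  so the rest is invariant and inherits avoidance.\<close>

lemma Inv_minus_arc:
  assumes p: "p \<in> Inv l n" and "l < b" and pl: "p l = b" and fx: "\<And>x. l < x \<Longrightarrow> x < b \<Longrightarrow> p x = x"
  shows "p \<circ> transpose l b \<in> Inv (Suc b) n"
proof -
  note inv = Inv_invol[OF p] and out = Inv_outside[OF p]
  define q where "q = p \<circ> transpose l b"
  have pb: "p b = l" using inv[of l] pl by simp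
  have bn: "b \<le> n" using Inv_inside[OF p, of l] pl out[of l] assms(2) by force
  have v: "q x = x" if "x < Suc b" for x
    using out[of x] fx[of x] pl pb that assms(2)
    by (cases x l rule: linorder_cases) (auto simp: q_def transpose_def)
  have v': "q x = p x" if "x \<ge> Suc b" for x
    using that assms(2) by (auto simp: q_def transpose_def)
  have qq: "q (q x) = x" for x
    unfolding q_def using inv pl pb assms(2) by (auto simp: transpose_def) (metis inv)+
  have pge: "p x \<ge> Suc b" if "x \<ge> Suc b" for x
    using qq[of x] v[of "q x"] v'[of x] that by (metis not_le)
  have "av3421 q"
    by (rule av3421_extend_left[where c = "Suc b" and p = p]) (use v v' pge Inv_av[OF p] in auto)
  moreover have "q x = x" if "x < Suc b \<or> n < x" for x
    using that v[of x] v'[of x] out[of x] assms(2) by (cases "x < Suc b") auto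
  ultimately show ?thesis using qq unfolding Inv_def q_def[symmetric] by simp
qed

text \<open>Linking the fixed point \<open>c\<close> to a new smallest point \<open>a\<close> creates no pattern because the value
  \<open>c\<close> at \<open>a\<close> could only play the role of 3, while the values below \<open>c\<close> to the right of
  the first larger one come in increasing order.\<close>

lemma av3421_link:
  assumes ab: "a < b" and c: "c = Suc b"
    and pp: "\<And>x. p (p x) = x" and qq: "\<And>x. q (q x) = x"
    and px: "\<And>x. x < b \<Longrightarrow> p x = x" and qx: "\<And>x. x < b \<Longrightarrow> x \<noteq> a \<Longrightarrow> q x = x"
    and pb: "p b > c" and qb: "q b = p b" and pc: "p c = c" and qa: "q a = c"
    and hi: "\<And>x. x > c \<Longrightarrow> q x = p x"
  shows "av3421 q \<longleftrightarrow> av3421 p"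
proof -
  have qc: "q c = a" using qq[of a] qa by simp
  have pin: "x = y" if "p x = p y" for x y using pp that by metis
  have big: "p x = b \<or> p x > c" if "x > c" for x
    using that px[of "p x"] pp[of x] pc pin[of x c] c by (metis Suc_lessI linorder_neqE_nat order_less_trans lessI)
  show ?thesis
  proof
    assume q: "av3421 q"
    show "av3421 p"
    proof (rule av3421I)
      fix i j k m assume o: "i < j" "j < k" "k < m" "p m < p k" "p k < p i" "p i < p j"
      have ib: "b \<le> i" by (rule Inv_occurrence_ge[of p b i m]) (use pp px o in auto)
      have ic: "i \<noteq> c" using o pc big[of k] big[of m] c by auto
      have jc: "j \<noteq> c" using o ib ic pb pc c by (cases "i = b") auto
      have "j > c" using ib ic jc o c by auto
      then have "q i = p i \<and> q j = p j \<and> q k = p k \<and> q m = p m"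
        using hi qb ib ic o c by (metis Suc_lessI le_neq_implies_less order_less_trans)
      then show False using av3421D[OF q o(1-3)] o by auto
    qed
  next
    assume p: "av3421 p"
    show "av3421 q"
    proof (rule av3421I)
      fix i j k m assume o: "i < j" "j < k" "k < m" "q m < q k" "q k < q i" "q i < q j"
      have ia: "a \<le> i" by (rule Inv_occurrence_ge[of q a i m]) (use qq qx ab o in auto)
      have jb: "b \<le> j" if "i = a"
        using that qa qx[of j] o c by force
      have low: "q x = a \<or> q x = b \<or> q x > c" if "x \<ge> c" for x
        using big[of x] hi[of x] qc that by (cases "x = c") auto
      have ina: "i \<noteq> a"
      proof
        assume i: "i = a"
        then have k: "k \<ge> c" "m > c" using jb o c by auto
        have "q m = b \<or> q m > c" using big[of m] hi[of m] k by auto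
        moreover have "q k = a \<or> q k = b \<or> q k > c" using low k by auto
        ultimately show False using i o qa ab c by auto
      qed
      \<comment> \<open>A fixed point strictly between \<open>a\<close> and \<open>b\<close> has
        only one smaller value to its right, namely \<open>a\<close> at position \<open>c\<close>;
        the pattern needs two.\<close>
      have ib: "b \<le> i"
      proof (rule ccontr)
        assume "\<not> b \<le> i"
        then have i: "i < b" "a < i" using ia ina by auto
        then have *: "q i = i" using qx by auto
        have "q x = a" if "x > i" "q x < i" for x
          using that i qx[of x] low[of x] qb pb c by (cases x b rule: linorder_cases) auto
        from this[of k] this[of m] show False using o * by auto
      qed
      have ic: "i \<noteq> c" using qc o low[of k] low[of m] ab c by auto
      have jc: "j \<noteq> c" using o ib ic qb pb qc ab c by (cases "i = b") auto
      have "j > c" using ib ic jc o c by auto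
      then have "q i = p i \<and> q j = p j \<and> q k = p k \<and> q m = p m"
        using hi qb ib ic o c by (metis Suc_lessI le_neq_implies_less order_less_trans)
      then show False using av3421D[OF p o(1-3)] o by auto
    qed
  qed
qed

text \<open>The new arc \<open>a\<close>--\<open>Suc b\<close> crosses the arc opened at
  \<open>b\<close>. This is the inverse step both in the recurrence, with \<open>b = a+2\<close>,
  and in the alternating case, with \<open>b = a+1\<close>.\<close>

lemma Inv_link:
  assumes p: "p \<in> Inv b n" and ab: "a < b" and pb: "p b > Suc b" and pc: "p (Suc b) = Suc b"
  shows "p \<circ> transpose a (Suc b) \<in> Inv a n"
proof -
  note inv = Inv_invol[OF p] and out = Inv_outside[OF p]
  define q where "q = p \<circ> transpose a (Suc b)"
  have bn: "b < n" using pb out[of "p b"] inv[of b] by fastforce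
  have pa: "p a = a" using out ab by auto
  have qq: "q (q x) = x" for x
    unfolding q_def using inv pa pc ab by (auto simp: transpose_def) (metis inv)+
  have v: "q a = Suc b" "q b = p b" using pc ab by (simp_all add: q_def transpose_def)
  have hi: "q x = p x" if "x > Suc b" for x using ab that by (simp add: q_def transpose_def)
  have qx: "q x = x" if "x < b" "x \<noteq> a" for x
    using out[of x] that by (simp add: q_def transpose_def)
  have "av3421 q = av3421 p"
    by (rule av3421_link[OF ab refl inv qq _ qx pb v(2) pc v(1) hi]) (simp_all add: out)
  then have "av3421 q" using Inv_av[OF p] by simp
  moreover have "q x = x" if "x < a \<or> n < x" for x
    using that qx[of x] hi[of x] out[of x] bn ab by auto
  ultimately show ?thesis using qq unfolding Inv_def q_def[symmetric] by simp
qed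

lemma Inv_unlink:
  assumes p: "p \<in> Inv a n" and ab: "a < b" and pb: "p b > Suc b" and pa: "p a = Suc b"
    and fx: "\<And>x. a < x \<Longrightarrow> x < b \<Longrightarrow> p x = x"
  shows "p \<circ> transpose a (Suc b) \<in> Inv b n"
proof -
  note inv = Inv_invol[OF p] and out = Inv_outside[OF p]
  define q where "q = p \<circ> transpose a (Suc b)"
  have pc: "p (Suc b) = a" using inv[of a] pa by simp
  have bn: "b < n" using pb out[of "p b"] inv[of b] by fastforce
  have qq: "q (q x) = x" for x
    unfolding q_def using inv pa pc ab by (auto simp: transpose_def) (metis inv)+
  have qb: "q x = x" if "x < b" for x
    using out[of x] fx[of x] that ab pc by (cases x a rule: linorder_cases) (auto simp: q_def transpose_def)
  have px: "p x = x" if "x < b" "x \<noteq> a" for x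
    using out[of x] fx[of x] that by (cases x a rule: linorder_cases) auto
  have v: "q b = p b" "q (Suc b) = Suc b" using pa ab by (simp_all add: q_def transpose_def)
  have hi: "p x = q x" if "x > Suc b" for x using ab that by (simp add: q_def transpose_def)
  \<comment> \<open>The roles in \<open>av3421_link\<close> are exchanged: here \<open>p\<close> is
    the linked permutation and \<open>q\<close> the one fixing \<open>Suc b\<close>.\<close>
  have "av3421 p = av3421 q"
    by (rule av3421_link[OF ab refl qq inv qb px _ v(1)[symmetric] v(2) pa hi]) (simp_all add: v pb)
  then have "av3421 q" using Inv_av[OF p] by simp
  moreover have "q x = x" if "x < b \<or> n < x" for x
    using that qb[of x] hi[of x] out[of x] bn ab by auto
  ultimately show ?thesis using qq unfolding Inv_def q_def[symmetric] by simp
qed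

text \<open>Here \<open>p\<close> has the adjacent arc \<open>b\<close>--\<open>c\<close> nested inside an arc \<open>a\<close>--\<open>d\<close>, and \<open>q\<close> is
  obtained by deleting \<open>b\<close>--\<open>c\<close> and letting the outer arc start at \<open>b\<close>.\<close>

lemma av3421_nest:
  assumes ab: "a < b" and c: "c = Suc b" and d: "c < d"
    and pp: "\<And>x. p (p x) = x" and qq: "\<And>x. q (q x) = x"
    and px: "\<And>x. x < b \<Longrightarrow> x \<noteq> a \<Longrightarrow> p x = x" and qx: "\<And>x. x < b \<Longrightarrow> q x = x"
    and pa: "p a = d" and pb: "p b = c" and qb: "q b = d" and qc: "q c = c"
    and hi: "\<And>x. x > c \<Longrightarrow> x \<noteq> d \<Longrightarrow> q x = p x"
  shows "av3421 q \<longleftrightarrow> av3421 p"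
    and "\<And>x y. c < x \<Longrightarrow> c < y \<Longrightarrow> p x < p y \<longleftrightarrow> q x < q y"
proof -
  have pc: "p c = b" and pd: "p d = a" and qd: "q d = b" 
    using pp[of a] pp[of b] qq[of b] pa pb qb by auto
  have big: "p x > c" if "x > c" "x \<noteq> d" for x
  proof (rule ccontr)
    assume "\<not> p x > c"
    then consider "p x = c" | "p x = b" | "p x = a" | "p x < b" "p x \<noteq> a" 
      using c by linarith
    then show False using pp[of x] pa pb pc px[of "p x"] that c by cases auto
  qed
  \<comment> \<open>Right of \<open>c\<close> only the value at \<open>d\<close> changes, from
    \<open>a\<close> to \<open>b\<close>, and both are smaller than all other values there. This
    comparison later transfers the zigzag condition.\<close>
  show cmp: "p x < p y \<longleftrightarrow> q x < q y" if "x > c" "y > c" for x y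
    using big[of x] big[of y] hi[of x] hi[of y] pd qd that ab c by (cases "x = d"; cases "y = d") auto
  have cmpd: "p x < d \<longleftrightarrow> q x < d" "d < p x \<longleftrightarrow> d < q x" if "x > c" for x
    using hi[of x] pd qd that ab c d by (cases "x = d"; auto)+
  show "av3421 q \<longleftrightarrow> av3421 p"
  proof
    assume q: "av3421 q"
    show "av3421 p"
    proof (rule av3421I)
      fix i j k m assume o: "i < j" "j < k" "k < m" "p m < p k" "p k < p i" "p i < p j"
      have ia: "a \<le> i" by (rule Inv_occurrence_ge[of p a i m]) (use pp px ab o in auto)
      \<comment> \<open>Only one such position exists, whereas occurrences starting between
        \<open>a\<close> and \<open>b\<close>, or at \<open>c\<close>, need two of them for the
        letters 2 and 1.\<close>
      have low: "x = d" if "a < x" "p x < b" "p x < x" for x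
        using that px[of x] pb pc big[of x] c by (cases x b rule: linorder_cases; cases "x = c") auto
      consider "i = a" | "a < i" "i < b" | "i = b" | "i = c" | "i > c" using ia c by linarith
      then show False
      proof cases
        case 1
        \<comment> \<open>The value \<open>d\<close> sits at \<open>a\<close> in \<open>p\<close>
          and at \<open>b\<close> in \<open>q\<close>; once \<open>j > c\<close>, the first position
          of the occurrence can be moved from \<open>a\<close> to \<open>b\<close>.\<close>
        have "j > c"
          using o 1 pa pb pc px[of j] c d by (cases "j = b"; cases "j = c"; cases "j < b") auto
        then show False using av3421D[OF q, of b j k m] 1 o cmp[of m k] cmpd pa qb c by auto
      next
        case 2
        then have "p i = i" using px by auto
        then show False using 2 o low[of k] low[of m] by auto
      next
        case 3
        then have "m > c" "k > c" using o c by auto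
        then show False using 3 o pb big[of k] big[of m] by (cases "k = d"; cases "m = d") auto
      next
        case 4
        then show False using o pc low[of k] low[of m] ab c by auto
      next
        case 5
        then show False using av3421D[OF q, of i j k m] o cmp by auto
      qed
    qed
  next
    assume p: "av3421 p"
    show "av3421 q"
    proof (rule av3421I)
      fix i j k m assume o: "i < j" "j < k" "k < m" "q m < q k" "q k < q i" "q i < q j"
      have ib: "b \<le> i" by (rule Inv_occurrence_ge[of q b i m]) (use qq qx o in auto)
      have low: "x = d" if "c < x" "q x < c" for x
        using that big[of x] hi[of x] by (cases "x = d") auto
      consider "i = b" | "i = c" | "i > c" using ib c by linarith
      then show False
      proof cases
        case 1
        then have "j > c" using o qb qc c d by (cases "j = c") auto
        then show False using av3421D[OF p, of a j k m] 1 o cmp[of m k] cmpd pa qb ab c by auto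
      next
        case 2
        then show False using o qc low[of k] low[of m] by auto
      next
        case 3
        then show False using av3421D[OF p, of i j k m] o cmp by auto
      qed
    qed
  qed
qed

section \<open>Recurrences for the cardinalities\<close>

lemma bij_betw_comp_transpose:
  assumes "\<And>p. p \<in> A \<Longrightarrow> p \<circ> transpose a b \<in> B" "\<And>p. p \<in> B \<Longrightarrow> p \<circ> transpose a b \<in> A"
  shows "bij_betw (\<lambda>p. p \<circ> transpose a b) A B"
  by (rule bij_betw_byWitness[where f' = "\<lambda>p. p \<circ> transpose a b"])
    (use assms in \<open>auto simp: comp_assoc\<close>)

lemma finite_Zig: "finite (Zig l n)" "finite (Fixed_second l n)" "finite (Long_zig l n)"
  by (rule finite_subset[OF _ finite_Inv[of l n]]; force simp: Zig_def Fixed_second_def Long_zig_def)+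

lemma Inv_ge: "p \<in> Inv l n \<Longrightarrow> l \<le> x \<Longrightarrow> l \<le> p x"
  by (metis Inv_inside Inv_outside not_le)

text \<open>If \<open>p l = l+1\<close>, the arc is an initial block that can be deleted.
  Conversely, inserting it makes \<open>l\<close> the value at \<open>l+1\<close>, so the ascent
  there is automatic.\<close>

lemma card_Zig:
  assumes "l < n"
  shows "card (Zig l n) = card (Long_zig l n) + card (Zig (l+2) n)"
proof -
  have "bij_betw (\<lambda>p. p \<circ> transpose l (l+1)) {p \<in> Zig l n. p l = l+1} (Zig (l+2) n)"
  proof (rule bij_betw_comp_transpose)
    fix p assume p: "p \<in> {p \<in> Zig l n. p l = l+1}"
    then have "p \<circ> transpose l (l+1) \<in> Inv (Suc (l+1)) n"
      by (intro Inv_minus_arc) (auto simp: Zig_def)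
    moreover have "zigzag (l+2) n (p \<circ> transpose l (l+1)) = zigzag (l+2) n p"
      by (rule zigzag_cong) (simp add: transpose_def)
    ultimately show "p \<circ> transpose l (l+1) \<in> Zig (l+2) n"
      using p by (auto simp: Zig_def zigzag_step[of l])
  next
    fix p assume p: "p \<in> Zig (l+2) n"
    then have "p \<circ> transpose l (l+1) \<in> Inv l n"
      using assms by (intro Inv_plus_arc) (auto simp: Zig_def)
    moreover have "zigzag (l+2) n (p \<circ> transpose l (l+1)) = zigzag (l+2) n p"
      by (rule zigzag_cong) (simp add: transpose_def)
    moreover have "p l = l" "p (l+1) = l+1" "p (l+2) \<ge> l+2"
      using p Inv_outside[of p "l+2" n] Inv_ge[of p "l+2" n "l+2"] by (auto simp: Zig_def)
    ultimately show "p \<circ> transpose l (l+1) \<in> {p \<in> Zig l n. p l = l+1}"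
      using p by (auto simp: Zig_def zigzag_step[of l] transpose_def)
  qed
  then have "card {p \<in> Zig l n. p l = l+1} = card (Zig (l+2) n)"
    by (rule bij_betw_same_card)
  moreover have "Zig l n = Long_zig l n \<union> {p \<in> Zig l n. p l = l+1}"
    using assms by (auto simp: Long_zig_def)
  moreover have "card (Long_zig l n \<union> {p \<in> Zig l n. p l = l+1})
      = card (Long_zig l n) + card {p \<in> Zig l n. p l = l+1}"
    by (rule card_Un_disjoint) (auto simp: finite_Zig, auto simp: Long_zig_def)
  ultimately show ?thesis by simp
qed

text \<open>The descent at the fixed point \<open>l+2\<close> forces the value \<open>l\<close> at
  \<open>l+3\<close>. The arc \<open>l\<close>--\<open>l+3\<close> over two fixed points is then an
  initial block.\<close>

lemma card_Fixed_second_fixed: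
  assumes "l+3 \<le> n"
  shows "card {p \<in> Fixed_second l n. p (l+2) = l+2} = card (Zig (l+4) n)"
proof -
  have eq: "zigzag (l+2) n p \<longleftrightarrow> p (l+3) < p (l+2) \<and> (l+3 < n \<longrightarrow> \<not> p (l+4) < p (l+3)) \<and> zigzag (l+4) n p" for p
    using zigzag_step[of "l+2" n p] assms by (simp add: numeral_eq_Suc)
  have "bij_betw (\<lambda>p. p \<circ> transpose l (l+3)) {p \<in> Fixed_second l n. p (l+2) = l+2} (Zig (l+4) n)"
  proof (rule bij_betw_comp_transpose)
    fix p assume "p \<in> {p \<in> Fixed_second l n. p (l+2) = l+2}"
    then have p: "p \<in> Inv l n" "p (l+1) = l+1" "p (l+2) = l+2" "p (l+3) < p (l+2)" "zigzag (l+4) n p"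
      unfolding Fixed_second_def eq by auto
    have "p (l+3) \<noteq> l+1" using Inv_invol[OF p(1), of "l+3"] p(2) by auto
    then have p3: "p (l+3) = l" using p Inv_ge[OF p(1), of "l+3"] by linarith
    then have pl: "p l = l+3" using Inv_invol[OF p(1), of "l+3"] by auto
    have "p \<circ> transpose l (l+3) \<in> Inv (Suc (l+3)) n"
    proof (rule Inv_minus_arc)
      show "p x = x" if "l < x" "x < l+3" for x
      proof -
        have "x = l+1 \<or> x = l+2" using that by linarith
        then show ?thesis using p by auto
      qed
    qed (use p pl in auto)
    moreover have "zigzag (l+4) n (p \<circ> transpose l (l+3)) = zigzag (l+4) n p"
      by (rule zigzag_cong) (simp add: transpose_def)
    ultimately show "p \<circ> transpose l (l+3) \<in> Zig (l+4) n"
      using p by (auto simp: Zig_def numeral_eq_Suc)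
  next
    fix p assume p: "p \<in> Zig (l+4) n"
    then have "p \<circ> transpose l (l+3) \<in> Inv l n"
      using assms by (intro Inv_plus_arc) (auto simp: Zig_def numeral_eq_Suc)
    moreover have "zigzag (l+4) n (p \<circ> transpose l (l+3)) = zigzag (l+4) n p"
      by (rule zigzag_cong) (simp add: transpose_def)
    moreover have "p l = l" "p (l+1) = l+1" "p (l+2) = l+2" "p (l+3) = l+3" "p (l+4) \<ge> l+4"
      using p Inv_outside[of p "l+4" n] Inv_ge[of p "l+4" n "l+4"] by (auto simp: Zig_def)
    ultimately show "p \<circ> transpose l (l+3) \<in> {p \<in> Fixed_second l n. p (l+2) = l+2}"
      using p assms unfolding Zig_def Fixed_second_def eq by (auto simp: transpose_def)
  qed
  then show ?thesis by (rule bij_betw_same_card)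
qed

text \<open>Otherwise the arcs from \<open>l\<close> and \<open>l+2\<close> both pass over
  \<open>l+3\<close>, which is fixed or opens a third arc. If \<open>l+3\<close> is fixed and
  \<open>p l < p (l+2)\<close>, the points \<open>l\<close>, \<open>l+2\<close> give 34 and
  \<open>l+3\<close>, \<open>p l\<close> give 21. In the other cases the ascent at
  \<open>l+3\<close> gives 34 and two closing points give 21.\<close>

lemma Fixed_second_fourth:
  assumes "l+3 \<le> n" and p: "p \<in> Fixed_second l n" and k: "p (l+2) > l+3"
  shows "p (l+3) = l" "p l = l+3"
proof -
  have I: "p \<in> Inv l n" and f: "p (l+1) = l+1" "p l > l+1" and z: "zigzag (l+2) n p"
    using p by (auto simp: Fixed_second_def)
  note inv = Inv_invol[OF I] and out = Inv_outside[OF I] and av = Inv_av[OF I]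
  have lt: "p (l+3) < p (l+2)" and asc: "l+3 < n \<Longrightarrow> \<not> p (l+4) < p (l+3)"
    using z[unfolded zigzag_step[of "l+2"]] assms(1) by (simp_all add: numeral_eq_Suc)
  have pin: "x = y" if "p x = p y" for x y using inv that by metis
  have asc: "p (l+3) < p (l+4)" if "l+3 < n"
    using asc[OF that] pin[of "l+3" "l+4"] by force
  show *: "p (l+3) = l"
  proof (rule ccontr)
    assume ne: "p (l+3) \<noteq> l"
    have j: "p l > l+3" 
    proof -
      have "p l \<noteq> l+2" using inv[of l] k by auto
      moreover have "p l \<noteq> l+3" using inv[of l] ne by auto
      ultimately show ?thesis using f by linarith
    qed
    have q: "p (l+3) \<ge> l+3"
    proof -
      have "p (l+3) \<noteq> l+2" using inv[of "l+3"] k by auto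
      moreover have "p (l+3) \<noteq> l+1" using inv[of "l+3"] f by auto
      moreover have "p (l+3) \<ge> l" by (rule Inv_ge[OF I]) simp
      ultimately show ?thesis using ne by linarith
    qed
    have n: "l+3 < n" using j out[of "p l"] inv[of l] by fastforce
    note asc = asc[OF n]
    have nk: "p l \<noteq> p (l+2)" using pin[of l "l+2"] by auto
    show False
    proof (cases "p (l+3) = l+3")
      case fixed: True
      show False
      proof (cases "p l < p (l+2)")
        case True
        show False
          by (rule av3421D[OF av, of l "l+2" "l+3" "p l"]) (use True fixed j inv in auto)
      next
        case False
        have "p (l+2) \<noteq> l+4" using inv[of "l+2"] asc fixed by auto
        then show False
          by (intro av3421D[OF av, of "l+3" "l+4" "p (l+2)" "p l"])
            (use False nk k asc fixed j inv in auto)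
      qed
    next
      case False
      have "p (l+3) \<noteq> l+4" using inv[of "l+3"] asc q by auto
      then show False
        by (intro av3421D[OF av, of "l+3" "l+4" "p (l+3)" "p (l+2)"])
          (use False q lt k asc j inv in auto)
    qed
  qed
  show "p l = l+3" using * inv[of "l+3"] by simp
qed

text \<open>By \<open>Fixed_second_fourth\<close> the arc \<open>l\<close>--\<open>l+3\<close>
  crosses the arc from \<open>l+2\<close>; removing it makes \<open>l+3\<close> the fixed second
  point of the window starting at \<open>l+2\<close>.\<close>

lemma card_Fixed_second_link:
  assumes "l+3 \<le> n"
  shows "card {p \<in> Fixed_second l n. p (l+2) > l+3} = card (Fixed_second (l+2) n)"
proof -
  have eq: "zigzag (l+2) n p \<longleftrightarrow> p (l+3) < p (l+2) \<and> (l+3 < n \<longrightarrow> \<not> p (l+4) < p (l+3)) \<and> zigzag (l+4) n p" for p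
    using zigzag_step[of "l+2" n p] assms by (simp add: numeral_eq_Suc)
  have "bij_betw (\<lambda>p. p \<circ> transpose l (l+3)) {p \<in> Fixed_second l n. p (l+2) > l+3} (Fixed_second (l+2) n)"
  proof (rule bij_betw_comp_transpose)
    fix p assume p0: "p \<in> {p \<in> Fixed_second l n. p (l+2) > l+3}"
    then have p: "p \<in> Inv l n" "p (l+1) = l+1" "p (l+2) > l+3" "zigzag (l+4) n p"
      unfolding Fixed_second_def eq by auto
    note f = Fixed_second_fourth[OF assms, of p]
    have "p \<circ> transpose l (Suc (l+2)) \<in> Inv (l+2) n"
    proof (rule Inv_unlink)
      show "p x = x" if "l < x" "x < l+2" for x
        using p that by (cases "x = l+1") auto
    qed (use p p0 f in \<open>auto simp: numeral_eq_Suc\<close>)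
    moreover have "zigzag (l+4) n (p \<circ> transpose l (l+3)) = zigzag (l+4) n p"
      by (rule zigzag_cong) (simp add: transpose_def)
    ultimately show "p \<circ> transpose l (l+3) \<in> Fixed_second (l+2) n"
      using p p0 f assms by (auto simp: Fixed_second_def numeral_eq_Suc transpose_def)
  next
    fix p assume p0: "p \<in> Fixed_second (l+2) n"
    then have p: "p \<in> Inv (l+2) n" "p (l+3) = l+3" "p (l+2) > l+3" "zigzag (l+4) n p"
      by (auto simp: Fixed_second_def numeral_eq_Suc)
    have "p \<circ> transpose l (Suc (l+2)) \<in> Inv l n"
      by (rule Inv_link) (use p in \<open>auto simp: numeral_eq_Suc\<close>)
    then have "p \<circ> transpose l (l+3) \<in> Inv l n" by (simp add: numeral_eq_Suc)
    moreover have "zigzag (l+4) n (p \<circ> transpose l (l+3)) = zigzag (l+4) n p"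
      by (rule zigzag_cong) (simp add: transpose_def)
    \<comment> \<open>After linking, \<open>l+3\<close> has value \<open>l\<close>, so the ascent
      there holds for every member of \<open>Fixed_second\<close>, whatever the order of its values
      at \<open>l+3\<close> and \<open>l+4\<close> was.\<close>
    moreover have "p l = l" "p (l+1) = l+1" "p (l+4) \<ge> l+2"
      using p Inv_outside[of p "l+2" n] Inv_ge[of p "l+2" n "l+4"] by auto
    ultimately show "p \<circ> transpose l (l+3) \<in> {p \<in> Fixed_second l n. p (l+2) > l+3}"
      using p assms unfolding Fixed_second_def eq by (auto simp: transpose_def)
  qed
  then show ?thesis by (rule bij_betw_same_card)
qed

text \<open>The arc \<open>l+2\<close>--\<open>l+3\<close> lies under the arc from \<open>l\<close>;
  deleting it and moving the outer left end to \<open>l+2\<close> frees \<open>l+3\<close> as the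
  fixed second point.\<close>

lemma card_Fixed_second_nest:
  assumes "l+3 \<le> n"
  shows "card {p \<in> Fixed_second l n. p (l+2) = l+3} = card (Long_zig (l+2) n)"
proof -
  define t s where "t = transpose l (l+3)" and "s = transpose l (l+2)"
  \<comment> \<open>Conjugation by \<open>s\<close> turns the arcs
    \<open>l\<close>--\<open>d\<close>, \<open>l+2\<close>--\<open>l+3\<close> into
    \<open>l+2\<close>--\<open>d\<close>, \<open>l\<close>--\<open>l+3\<close>; composing with
    \<open>t\<close> then erases the latter. \<open>G\<close> undoes the two moves in reverse
    order.\<close>
  define F G where "F = (\<lambda>p. s \<circ> p \<circ> s \<circ> t)" and "G = (\<lambda>p. s \<circ> (p \<circ> t) \<circ> s)"
  have tt: "t (t x) = x" "s (s x) = x" for x by (simp_all add: t_def s_def)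
  have eq: "zigzag (l+2) n p \<longleftrightarrow> p (l+3) < p (l+2) \<and> (l+3 < n \<longrightarrow> \<not> p (l+4) < p (l+3)) \<and> zigzag (l+4) n p" for p
    using zigzag_step[of "l+2" n p] assms by (simp add: numeral_eq_Suc)
  have zcong: "zigzag (l+4) n p = zigzag (l+4) n q"
    if "\<And>x y. l+3 < x \<Longrightarrow> l+3 < y \<Longrightarrow> p x < p y \<longleftrightarrow> q x < q y" for p q :: "nat \<Rightarrow> nat"
    by (rule zigzag_cong) (use that in auto)
  have "bij_betw F {p \<in> Fixed_second l n. p (l+2) = l+3} (Long_zig (l+2) n)"
  proof (rule bij_betw_byWitness[where f' = G]; (intro ballI image_subsetI)?)
    fix p assume "p \<in> {p \<in> Fixed_second l n. p (l+2) = l+3}"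
    then have p: "p \<in> Inv l n" "p (l+1) = l+1" "p l > l+1" "p (l+2) = l+3"
       "l+3 < n \<longrightarrow> \<not> p (l+4) < p (l+3)" "zigzag (l+4) n p"
      unfolding Fixed_second_def eq by auto
    note inv = Inv_invol[OF p(1)] and out = Inv_outside[OF p(1)]
    define d where "d = p l"
    have p3: "p (l+3) = l+2" and pd: "p d = l" using inv[of "l+2"] inv[of l] p(4) by (auto simp: d_def)
    have "d \<noteq> l+2" "d \<noteq> l+3" using pd p(4) p3 by auto
    then have d: "d > l+3" using p(3) d_def by linarith
    have dn: "d \<le> n" using out[of d] pd d by force
    define q where "q = F p"
    have q: "q l = l" "q (l+1) = l+1" "q (l+2) = d" "q (l+3) = l+3" "q d = l+2"
      using p(2-4) p3 pd d by (auto simp: q_def F_def s_def t_def transpose_def d_def)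
    have qp: "q x = p x" if "x \<notin> {l, l+2, l+3, d}" for x
    proof -
      have "x \<noteq> p l" "x \<noteq> p (l+2)"
        using that p(4) d_def by auto
      then have "p x \<noteq> l" "p x \<noteq> l+2"
        using inv[of x] by metis+
      then show ?thesis using that by (auto simp: q_def F_def s_def t_def transpose_def)
    qed
    have qq: "q (q x) = x" for x
    proof (cases "x \<in> {l, l+2, l+3, d}")
      case True then show ?thesis using q by auto
    next
      case False
      then have "x \<noteq> p l" "x \<noteq> p (l+2)" "x \<noteq> p (l+3)" "x \<noteq> p d" using p3 pd p(4) d_def by auto
      then have "p x \<notin> {l, l+2, l+3, d}" using inv[of x] by (metis insertE empty_iff)
      then show ?thesis using qp False inv by simp
    qed
    have qlow: "q x = x" if "x < l+2" for x
    proof -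
      have "x < l \<or> x = l \<or> x = l+1" using that by linarith
      then show ?thesis using q(1,2) qp[of x] d out[of x] by auto
    qed
    have plow: "p x = x" if "x < l+2" "x \<noteq> l" for x
    proof -
      have "x < l \<or> x = l+1" using that by linarith
      then show ?thesis using p(2) out[of x] by auto
    qed
    have hi: "q x = p x" if "x > l+3" "x \<noteq> d" for x using qp that by auto
    note nest = av3421_nest[of l "l+2" "l+3" d p q, OF _ _ d inv qq plow qlow d_def[symmetric] p(4) q(3,4) hi]
    have n: "av3421 q = av3421 p" "\<And>x y. l+3 < x \<Longrightarrow> l+3 < y \<Longrightarrow> p x < p y \<longleftrightarrow> q x < q y"
      by (rule nest; simp)+
    have I: "q \<in> Inv (l+2) n"
      using qq qlow n(1) Inv_av[OF p(1)] qp out d dn unfolding Inv_def by auto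
    \<comment> \<open>The ascent at \<open>l+3\<close>, where \<open>p\<close> has value
      \<open>l+2\<close>, keeps the outer arc from closing at \<open>l+4\<close>. Hence
      \<open>q\<close> ascends at \<open>l+3\<close>, which is why the image is
      \<open>Long_zig\<close> and not all of \<open>Fixed_second\<close>.\<close>
    have p4: "p (l+4) \<ge> l+2" using p(5) p3 d dn by linarith
    then have "l+4 \<noteq> d" using pd by auto
    then have "q (l+4) \<noteq> l+2" "q (l+4) \<noteq> l+3" using qq[of "l+4"] q by auto
    then have q4: "q (l+4) > l+3" using Inv_ge[OF I, of "l+4"] by linarith
    show "F p \<in> Long_zig (l+2) n"
      using I q q4 zcong[OF n(2)] p(6) d dn
      unfolding Long_zig_eq Fixed_second_def q_def[symmetric] by (simp add: numeral_eq_Suc)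
  next
    fix q assume "q \<in> Long_zig (l+2) n"
    then have q: "q \<in> Inv (l+2) n" "q (l+3) = l+3" "q (l+2) > l+3" "l+3 < n"
       "q (l+4) > l+3" "zigzag (l+4) n q"
      unfolding Long_zig_eq Fixed_second_def by (auto simp: numeral_eq_Suc)
    note inv = Inv_invol[OF q(1)] and out = Inv_outside[OF q(1)]
    define d where "d = q (l+2)"
    have qd: "q d = l+2" using inv[of "l+2"] by (auto simp: d_def)
    have d: "d > l+3" using q(3) d_def by linarith
    have dn: "d \<le> n" using out[of d] qd d by force
    have qlow: "q x = x" if "x < l+2" for x using out that by auto
    define p where "p = G q"
    have p: "p l = d" "p (l+1) = l+1" "p (l+2) = l+3" "p (l+3) = l+2" "p d = l"
      using q(2) qlow[of l] qlow[of "l+1"] qd d by (auto simp: p_def G_def s_def t_def transpose_def d_def)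
    have pq: "p x = q x" if "x \<notin> {l, l+2, l+3, d}" for x
    proof -
      have "x \<noteq> q l" "x \<noteq> q (l+2)"
        using that qlow[of l] d_def by auto
      then have "q x \<noteq> l" "q x \<noteq> l+2"
        using inv[of x] by metis+
      then show ?thesis using that by (auto simp: p_def G_def s_def t_def transpose_def)
    qed
    have pp: "p (p x) = x" for x
    proof (cases "x \<in> {l, l+2, l+3, d}")
      case True then show ?thesis using p by auto
    next
      case False
      then have "x \<noteq> q l" "x \<noteq> q (l+2)" "x \<noteq> q (l+3)" "x \<noteq> q d" using qlow[of l] qd q(2) d_def by auto
      then have "q x \<notin> {l, l+2, l+3, d}" using inv[of x] by (metis insertE empty_iff)
      then show ?thesis using pq False inv by simp
    qed
    have plow: "p x = x" if "x < l+2" "x \<noteq> l" for x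
      using that pq[of x] qlow[of x] d by auto
    have hi: "q x = p x" if "x > l+3" "x \<noteq> d" for x using pq that by auto
    note nest = av3421_nest[of l "l+2" "l+3" d p q, OF _ _ d pp inv plow qlow p(1,3) d_def[symmetric] q(2) hi]
    have n: "av3421 q = av3421 p" "\<And>x y. l+3 < x \<Longrightarrow> l+3 < y \<Longrightarrow> p x < p y \<longleftrightarrow> q x < q y"
      by (rule nest; simp)+
    have I: "p \<in> Inv l n"
      using pp plow n(1) Inv_av[OF q(1)] pq out d dn unfolding Inv_def by auto
    have "l+4 \<noteq> d" using q(5) qd by auto
    then have "p (l+4) > l+3" using q(5) pq[of "l+4"] by simp
    then show "G q \<in> {p \<in> Fixed_second l n. p (l+2) = l+3}"
      using I p zcong[OF n(2)] q(6) d dn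
      unfolding Fixed_second_def eq p_def[symmetric] by simp
  qed (simp_all add: F_def G_def fun_eq_iff tt)
  then show ?thesis by (rule bij_betw_same_card)
qed

text \<open>The value at \<open>l+2\<close> is at least \<open>l+2\<close>: \<open>l\<close>
  contradicts the descent there and \<open>l+1\<close> is fixed. By \<open>card_Zig\<close> the last
  two summands add up to the cardinality of \<open>Zig (l+2) n\<close>.\<close>

lemma card_Fixed_second:
  assumes "l+3 \<le> n"
  shows "card (Fixed_second l n) = card (Fixed_second (l+2) n) + card (Long_zig (l+2) n) + card (Zig (l+4) n)"
proof -
  let ?A = "{p \<in> Fixed_second l n. p (l+2) > l+3}"
  let ?B = "{p \<in> Fixed_second l n. p (l+2) = l+3}"
  let ?C = "{p \<in> Fixed_second l n. p (l+2) = l+2}"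
  have ge: "p (l+2) \<ge> l+2" if p: "p \<in> Fixed_second l n" for p
  proof -
    have I: "p \<in> Inv l n" and f: "p (l+1) = l+1" and z: "zigzag (l+2) n p"
      using p by (auto simp: Fixed_second_def)
    have lt: "p (l+3) < p (l+2)" using z[unfolded zigzag_step[of "l+2"]] assms
      by (simp add: numeral_eq_Suc)
    have "p (l+2) \<noteq> l" 
      using lt Inv_ge[OF I, of "l+3"] by auto
    moreover have "p (l+2) \<noteq> l+1" using Inv_invol[OF I, of "l+2"] f by auto
    ultimately show ?thesis using Inv_ge[OF I, of "l+2"] by linarith
  qed
  then have "p (l+2) > l+3 \<or> p (l+2) = l+3 \<or> p (l+2) = l+2" if "p \<in> Fixed_second l n" for p
    using ge[OF that] by linarith
  moreover have fin: "finite {p \<in> Fixed_second l n. P p}" for P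
    by (simp add: finite_Zig)
  ultimately have "Fixed_second l n = (?A \<union> ?B) \<union> ?C" by blast
  then have "card (Fixed_second l n) = card ((?A \<union> ?B) \<union> ?C)" by (rule arg_cong)
  also have "\<dots> = card (?A \<union> ?B) + card ?C"
    by (rule card_Un_disjoint[OF finite_UnI[OF fin fin] fin]) fastforce
  also have "card (?A \<union> ?B) = card ?A + card ?B"
    by (rule card_Un_disjoint[OF fin fin]) fastforce
  finally show ?thesis
    using card_Fixed_second_link[OF assms] card_Fixed_second_nest[OF assms]
      card_Fixed_second_fixed[OF assms] by simp
qed

section \<open>Small windows and the Fibonacci numbers\<close>

lemma Zig_trivial:
  assumes "n \<le> l"
  shows "Zig l n = {id}"
proof -
  have "p = id" if p: "p \<in> Inv l n" for p
  proof
    fix x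
    have "p y = y" if "y \<noteq> l" for y using Inv_outside[OF p, of y] that assms by (cases y l rule: linorder_cases) auto
    then show "p x = id x" using Inv_invol[OF p, of l] by (metis id_apply)
  qed
  moreover have "id \<in> Inv l n" by (auto simp: Inv_def av3421_def)
  ultimately show ?thesis using assms by (auto simp: Zig_def zigzag_def)
qed

lemma Fixed_second_1: "Fixed_second l (Suc l) = {}"
proof -
  have False if "p \<in> Fixed_second l (Suc l)" for p
    using that Inv_inside[of p l "Suc l" l] by (auto simp: Fixed_second_def)
  then show ?thesis by blast
qed

lemma Fixed_second_2: "Fixed_second l (l+2) = {transpose l (l+2)}"
proof -
  have "p = transpose l (l+2)" if p: "p \<in> Fixed_second l (l+2)" for p
  proof -
    have I: "p \<in> Inv l (l+2)" and f: "p (l+1) = l+1" "p l > l+1"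
      using p by (auto simp: Fixed_second_def)
    have 1: "p l = l+2" using f Inv_inside[OF I, of l] by simp
    then have 2: "p (l+2) = l" using Inv_invol[OF I, of l] by simp
    have "p x = x" if "x \<noteq> l" "x \<noteq> l+2" for x
    proof -
      have "x < l \<or> l+2 < x \<or> x = l+1" using that by linarith
      then show ?thesis using Inv_outside[OF I, of x] f(1) by auto
    qed
    with 1 2 show ?thesis by (auto simp: fun_eq_iff transpose_def)
  qed
  moreover have "av3421 (transpose l (l+2))"
  proof (rule av3421I)
    fix i j k m :: nat
    let ?p = "transpose l (l+2)"
    assume o: "i < j" "j < k" "k < m" "?p m < ?p k" "?p k < ?p i" "?p i < ?p j"
    have "l \<le> i" by (rule Inv_occurrence_ge[of ?p l i m]) (use o in \<open>auto simp: transpose_def\<close>)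
    then show False using o by (auto simp: transpose_def split: if_splits)
  qed
  ultimately show ?thesis by (auto simp: Fixed_second_def Inv_def zigzag_def transpose_def)
qed

lemma Long_zig_trivial:
  assumes "n \<le> l+2"
  shows "Long_zig l n = {}"
proof -
  have False if p: "p \<in> Long_zig l n" for p
  proof -
    have n: "n = l+2" using Zig_second_fixed(3)[OF p] assms by simp
    have "p \<in> Fixed_second l n" "p (l+1) < p (l+2)" using p by (auto simp: Long_zig_eq)
    then show False unfolding n Fixed_second_2 by (simp add: transpose_def)
  qed
  then show ?thesis by blast
qed

text \<open>The window has \<open>d+2\<close> points, so indices are shifted by one against
  \<open>s\<close> and \<open>b\<close>. The recurrences go down by two, and \<open>d = 1\<close> is
  a separate base case because \<open>Fixed_second\<close> and \<open>Long_zig\<close> differ on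
  three points.\<close>

lemma card_Zig_Fixed_second_fib:
  "n = l + Suc d \<Longrightarrow> card (Zig l n) = fib (Suc d) \<and> card (Fixed_second l n) = fib d"
proof (induction d arbitrary: l rule: less_induct)
  case (less d)
  note n = less.prems
  consider "d = 0" | "d = 1" | "d \<ge> 2" by linarith
  then show ?case
  proof cases
    case 1
    then show ?thesis using n card_Zig[of l n] Zig_trivial[of n "l+2"] Long_zig_trivial[of n l]
      by (simp add: Fixed_second_1)
  next
    case 2
    have "card (Fixed_second l n) = 1" using n 2 Fixed_second_2[of l] by simp
    then show ?thesis using n 2 card_Zig[of l n] Zig_trivial[of n "l+2"] Long_zig_trivial[of n l]
      by simp
  next
    case 3
    define e where "e = d - 2"
    have d: "d = Suc (Suc e)" using 3 by (simp add: e_def)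
    have IH: "card (Zig (l+2) n) = fib (Suc e)" "card (Fixed_second (l+2) n) = fib e"
      using less.IH[of e "l+2"] n d by simp_all
    have "card (Long_zig (l+2) n) + card (Zig (l+4) n) = fib (Suc e)"
      using card_Zig[of "l+2" n] IH n d by (simp add: numeral_eq_Suc)
    then have F: "card (Fixed_second l n) = fib d"
      using card_Fixed_second[of l n] n d IH by simp
    moreover have "card (Zig l n) = card (Fixed_second l n) + card (Zig (l+2) n)"
      using card_Zig[of l n] Fixed_second_eq_Long_zig[of l n] n d by simp
    ultimately show ?thesis using IH d by simp
  qed
qed

section \<open>Translation into pattern avoidance and alternation\<close>

text \<open>In an involution positions and values may be exchanged. This turns an occurrence of 4312
  at \<open>f\<close> into one of 3421 at the positions \<open>p (f 2)\<close>,
  \<open>p (f 3)\<close>, \<open>p (f 1)\<close>, \<open>p (f 0)\<close>.\<close>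

lemma av3421_iff_avoids:
  assumes I: "\<And>x. p (p x) = x" "\<And>x. x \<notin> {1..n} \<Longrightarrow> p x = x"
  shows "av3421 p \<longleftrightarrow> avoids n p [3,4,2,1] \<and> avoids n p [4,3,1,2]"
proof -
  have A: "contains_pattern n p [3,4,2,1]" if o: "i < j" "j < k" "k < m" "p m < p k" "p k < p i" "p i < p j" for i j k m
  proof -
    \<comment> \<open>An occurrence among arbitrary naturals lies in \<open>{1..n}\<close>, because
      the points outside are fixed and take part in no inversion.\<close>
    have i: "1 \<le> i" by (rule Inv_occurrence_ge[of p 1 i m]) (use I o in auto)
    have m: "m \<le> n"
    proof (rule ccontr)
      assume "\<not> m \<le> n"
      then have "p m = m" "p (p k) = p k" using I(2)[of m] I(2)[of "p k"] o(4) by auto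
      then show False using I(1)[of k] o by simp
    qed
    define f where "f = (\<lambda>a. [i,j,k,m] ! a)"
    have "strict_mono_on {..<length [3::nat,4,2,1]} f"
      by (auto simp: strict_mono_on_def f_def numeral_eq_Suc less_Suc_eq) (use o in auto)
    moreover have "f ` {..<length [3::nat,4,2,1]} \<subseteq> {1..n}"
      using o i m by (auto simp: f_def numeral_eq_Suc less_Suc_eq)
    moreover have "\<forall>a<length [3::nat,4,2,1]. \<forall>b<length [3::nat,4,2,1]. p (f a) < p (f b) \<longleftrightarrow> [3::nat,4,2,1] ! a < [3,4,2,1] ! b"
      using o by (auto simp: f_def numeral_eq_Suc All_less_Suc)
    ultimately show ?thesis unfolding contains_pattern_def by blast
  qed
  have len: "length [a, b, c, d] = 4" for a b c d :: nat by simp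
  have mono: "f 0 < f 1 \<and> f 1 < f 2 \<and> f 2 < f (3::nat)" if "strict_mono_on {..<4} f" for f :: "nat \<Rightarrow> nat"
    using that by (simp add: strict_mono_on_def)
  have B: "\<not> av3421 p" if c: "contains_pattern n p [3,4,2,1]"
  proof -
    obtain f where f: "strict_mono_on {..<4} f" 
      "\<forall>a<4. \<forall>b<4. p (f a) < p (f b) \<longleftrightarrow> [3::nat,4,2,1] ! a < [3,4,2,1] ! b"
      using c unfolding contains_pattern_def len by blast
    have "p (f 3) < p (f 2)" "p (f 2) < p (f 0)" "p (f 0) < p (f 1)"
      using f(2) by (simp_all add: numeral_eq_Suc)
    then show ?thesis using mono[OF f(1)] unfolding av3421_def by blast
  qed
  have C: "\<not> av3421 p" if c: "contains_pattern n p [4,3,1,2]"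
  proof -
    obtain f where f: "strict_mono_on {..<4} f" 
      "\<forall>a<4. \<forall>b<4. p (f a) < p (f b) \<longleftrightarrow> [4::nat,3,1,2] ! a < [4,3,1,2] ! b"
      using c unfolding contains_pattern_def len by blast
    have "p (f 2) < p (f 3)" "p (f 3) < p (f 1)" "p (f 1) < p (f 0)"
      using f(2) by (simp_all add: numeral_eq_Suc)
    then show ?thesis 
      using mono[OF f(1)] av3421D[of p "p (f 2)" "p (f 3)" "p (f 1)" "p (f 0)"] I(1) by auto
  qed
  show ?thesis using A B C unfolding avoids_def av3421_def by blast
qed

lemma Inv_1_iff:
  "p \<in> Inv 1 n \<longleftrightarrow> p permutes {1..n} \<and> inv p = p \<and> avoids n p [3,4,2,1] \<and> avoids n p [4,3,1,2]"
proof
  assume I: "p \<in> Inv 1 n"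
  have pp: "p (p x) = x" for x using Inv_invol[OF I] .
  have out: "p x = x" if "x \<notin> {1..n}" for x using that Inv_outside[OF I, of x] by auto
  have "p permutes {1..n}"
    unfolding permutes_def using out pp by metis
  moreover have "inv p = p" by (rule inv_unique_comp) (auto simp: pp)
  ultimately show "p permutes {1..n} \<and> inv p = p \<and> avoids n p [3,4,2,1] \<and> avoids n p [4,3,1,2]"
    using av3421_iff_avoids[OF pp out] Inv_av[OF I] by simp
next
  assume p: "p permutes {1..n} \<and> inv p = p \<and> avoids n p [3,4,2,1] \<and> avoids n p [4,3,1,2]"
  then have pp: "p (p x) = x" for x using permutes_inverses(2)[of p "{1..n}" x] by simp
  have out: "p x = x" if "x \<notin> {1..n}" for x by (rule permutes_not_in[OF conjunct1[OF p] that])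
  have "p x = x" if "x < 1 \<or> n < x" for x by (rule out) (use that in auto)
  then show "p \<in> Inv 1 n"
    using av3421_iff_avoids[OF pp out] p pp by (simp add: Inv_def)
qed

lemma RAI_avoiding_eq: "RAI_avoiding n [3,4,2,1] [4,3,1,2] = Zig 1 n"
proof -
  have "reverse_alternating n p \<longleftrightarrow> zigzag 1 n p" for p
    by (force simp: reverse_alternating_def zigzag_def)
  then show ?thesis
    unfolding RAI_avoiding_def RAI_def Zig_def using Inv_1_iff[of _ n] by blast
qed

text \<open>Neighbouring values differ, so an ascent is exactly a non-descent;
  \<open>2 \<le> n\<close> makes position 1 carry a condition.\<close>

lemma AI_avoiding_eq:
  assumes "2 \<le> n"
  shows "AI_avoiding n [3,4,2,1] [4,3,1,2] = {p \<in> Inv 1 n. p 1 < p 2 \<and> zigzag 2 n p}"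
proof -
  have "alternating n p \<longleftrightarrow> p 1 < p 2 \<and> zigzag 2 n p" if "p \<in> Inv 1 n" for p
  proof -
    have "p (Suc i) \<noteq> p i" for i using Inv_invol[OF that] by (metis n_not_Suc_n)
    then have ne: "p i < p (i+1) \<longleftrightarrow> \<not> p (Suc i) < p i" for i
      by (metis Suc_eq_plus1 linorder_neqE_nat order_less_asym)
    have "alternating n p \<longleftrightarrow> (\<forall>i\<in>insert 1 {2..<n}. p i < p (i+1) \<longleftrightarrow> odd i)"
    proof -
      have "{1..<n} = insert 1 {2..<n}" using assms by auto
      then show ?thesis by (simp only: alternating_def)
    qed
    also have "\<dots> \<longleftrightarrow> p 1 < p 2 \<and> (\<forall>i\<in>{2..<n}. p (Suc i) < p i \<longleftrightarrow> even i)"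
      unfolding ball_simps ne[symmetric] by (simp add: ne one_add_one del: One_nat_def)
    also have "\<dots> \<longleftrightarrow> p 1 < p 2 \<and> zigzag 2 n p"
      by (auto simp: zigzag_def)
    finally show ?thesis .
  qed
  then show ?thesis
    unfolding AI_avoiding_def AI_def using Inv_1_iff[of _ n] by blast
qed

section \<open>The alternating case\<close>

text \<open>If \<open>l\<close> is not fixed, its arc must close at \<open>l+2\<close>. Otherwise it
  passes over \<open>l+2\<close>: if \<open>l+2\<close> is fixed, \<open>l\<close>,
  \<open>l+1\<close>, \<open>l+2\<close>, \<open>p l\<close> carry 3421, and if it opens an arc,
  \<open>l+2\<close>, \<open>l+3\<close>, \<open>p (l+2)\<close>, \<open>p (l+1)\<close> do.
  Unlinking \<open>l\<close> leaves \<open>l+2\<close> as the fixed second point of the window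
  starting at \<open>l+1\<close>.\<close>

lemma card_ascending_link:
  "card {p \<in> Inv l n. l < n \<and> p l < p (l+1) \<and> zigzag (l+1) n p \<and> p l \<noteq> l} = card (Fixed_second (l+1) n)"
proof -
  have "bij_betw (\<lambda>p. p \<circ> transpose l (l+2))
     {p \<in> Inv l n. l < n \<and> p l < p (l+1) \<and> zigzag (l+1) n p \<and> p l \<noteq> l} (Fixed_second (l+1) n)"
  proof (rule bij_betw_comp_transpose)
    fix p assume "p \<in> {p \<in> Inv l n. l < n \<and> p l < p (l+1) \<and> zigzag (l+1) n p \<and> p l \<noteq> l}"
    then have I: "p \<in> Inv l n" and n: "l < n" and a1: "p l < p (l+1)"
      and z: "zigzag (l+1) n p" and pl: "p l \<noteq> l" by auto
    note inv = Inv_invol[OF I] and out = Inv_outside[OF I] and av = Inv_av[OF I]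
    have pin: "x = y" if "p x = p y" for x y using inv that by metis
    have pl1: "p l \<noteq> l+1" using inv[of l] a1 by auto
    then have pl2: "p l \<ge> l+2" using Inv_ge[OF I, of l] pl by linarith
    have n2: "l+2 \<le> n" using out[of "p l"] inv[of l] pl pl2 by force
    note st = z[unfolded zigzag_step[of "l+1"]]
    have d: "p (l+2) < p (l+1)" using st n2 by (simp add: numeral_eq_Suc)
    have asc: "p (l+2) < p (l+3)" if "l+2 < n"
      using st that pin[of "l+2" "l+3"] by (force simp: numeral_eq_Suc)
    have z3: "zigzag (l+3) n p" using st by (simp add: numeral_eq_Suc)
    have p3: "p (l+2) = l"
    proof (rule ccontr)
      assume ne: "p (l+2) \<noteq> l"
      have "p l \<noteq> l+2" using inv[of l] ne by auto
      then have j: "p l > l+2" using pl2 by linarith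
      have n: "l+2 < n" using out[of "p l"] inv[of l] j by fastforce
      have "p (l+2) \<noteq> l+1" using inv[of "l+2"] a1 j by auto
      then have q: "p (l+2) \<ge> l+2" using Inv_ge[OF I, of "l+2"] ne by linarith
      show False
      proof (cases "p (l+2) = l+2")
        case True
        show False
          by (rule av3421D[OF av, of l "l+1" "l+2" "p l"]) (use True j inv a1 in auto)
      next
        case False
        have "p (l+2) \<noteq> l+3" using inv[of "l+2"] asc[OF n] q by auto
        then show False
          by (intro av3421D[OF av, of "l+2" "l+3" "p (l+2)" "p (l+1)"])
            (use False q d asc[OF n] inv in auto)
      qed
    qed
    then have pl: "p l = l+2" using inv[of "l+2"] by simp
    have "p \<circ> transpose l (Suc (l+1)) \<in> Inv (l+1) n"
      by (rule Inv_unlink) (use I pl a1 in auto)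
    moreover have "zigzag (l+3) n (p \<circ> transpose l (l+2)) = zigzag (l+3) n p"
      by (rule zigzag_cong) (simp add: transpose_def)
    ultimately show "p \<circ> transpose l (l+2) \<in> Fixed_second (l+1) n"
      using pl p3 a1 z3 n2 by (auto simp: Fixed_second_def transpose_def numeral_eq_Suc)
  next
    fix p assume "p \<in> Fixed_second (l+1) n"
    then have p: "p \<in> Inv (l+1) n" "p (l+2) = l+2" "p (l+1) > l+2" "zigzag (l+3) n p" "l+1 < n"
      by (auto simp: Fixed_second_def numeral_eq_Suc)
    have "p \<circ> transpose l (Suc (l+1)) \<in> Inv l n"
      by (rule Inv_link) (use p in auto)
    moreover have "p l = l" "p (l+3) \<ge> l+1" using Inv_outside[OF p(1)] Inv_ge[OF p(1), of "l+3"] by auto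
    moreover have "zigzag (l+3) n (p \<circ> transpose l (l+2)) = zigzag (l+3) n p"
      by (rule zigzag_cong) (simp add: transpose_def)
    ultimately show "p \<circ> transpose l (l+2) \<in> {p \<in> Inv l n. l < n \<and> p l < p (l+1) \<and> zigzag (l+1) n p \<and> p l \<noteq> l}"
      using p zigzag_step[of "l+1" n "p \<circ> transpose l (l+2)"]
      by (auto simp: transpose_def numeral_eq_Suc)
  qed
  then show ?thesis by (rule bij_betw_same_card)
qed

text \<open>If 1 is fixed, the ascent at 1 is automatic and any member of \<open>Zig 2 n\<close> may
  follow; the remaining case is \<open>card_ascending_link\<close>.\<close>

lemma card_AI_avoiding:
  assumes "2 \<le> n"
  shows "card (AI_avoiding n [3,4,2,1] [4,3,1,2]) = card (Zig 2 n) + card (Fixed_second 2 n)"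
proof -
  let ?A = "{p \<in> Inv 1 n. 1 < n \<and> p 1 < p (1+1) \<and> zigzag (1+1) n p \<and> p 1 \<noteq> 1}"
  have "p \<in> Inv 2 n \<longleftrightarrow> p \<in> Inv 1 n \<and> p 1 = 1" for p
  proof -
    have "(\<forall>x. x < 2 \<or> n < x \<longrightarrow> p x = x) \<longleftrightarrow> (\<forall>x. x < 1 \<or> n < x \<longrightarrow> p x = x) \<and> p 1 = 1"
      by (auto simp: numeral_eq_Suc less_Suc_eq)
    then show ?thesis by (auto simp: Inv_def)
  qed
  moreover have "1 < p 2" if "p \<in> Inv 2 n" for p using Inv_ge[OF that, of 2] by simp
  ultimately have "AI_avoiding n [3,4,2,1] [4,3,1,2] = Zig 2 n \<union> ?A"
    unfolding AI_avoiding_eq[OF assms] Zig_def one_add_one using assms by fastforce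
  moreover have "card (Zig 2 n \<union> ?A) = card (Zig 2 n) + card ?A"
    by (rule card_Un_disjoint)
      (auto simp: finite_Zig finite_Inv Zig_def Inv_outside[of _ 2 n])
  ultimately show ?thesis using card_ascending_link[of 1 n] unfolding one_add_one by (simp only:)
qed

theorem theorem8p1:
  fixes n :: nat
  assumes "n \<ge> 2"
  shows "card (AI_avoiding n [3,4,2,1] [4,3,1,2]) = fib (n - 1) \<and>
         card (RAI_avoiding n [3,4,2,1] [4,3,1,2]) = fib (n - 1)"
proof
  obtain d where d: "n = Suc (Suc d)" using assms by (metis Suc_le_D numeral_2_eq_2 Suc_le_mono)
  show "card (RAI_avoiding n [3,4,2,1] [4,3,1,2]) = fib (n - 1)"
    using card_Zig_Fixed_second_fib[of n 1 d] d unfolding RAI_avoiding_eq by simp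
  show "card (AI_avoiding n [3,4,2,1] [4,3,1,2]) = fib (n - 1)"
  proof (cases d)
    \<comment> \<open>For \<open>n = 2\<close> the window starting at 2 is a single point, below the
      range of \<open>card_Zig_Fixed_second_fib\<close>; only the identity is counted.\<close>
    case 0
    have "Fixed_second 2 n = {}" using d 0 by (auto simp: Fixed_second_def)
    then show ?thesis using card_AI_avoiding[OF assms] Zig_trivial[of n 2] d 0 by simp
  next
    case (Suc e)
    then show ?thesis using card_AI_avoiding[OF assms] card_Zig_Fixed_second_fib[of n 2 e] d by simp
  qed
qed

end
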